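(* Let $X=\{X(t), t\in\mathbb{Z}\}$ be a (strictly) stationary real-valued max-infinitely divisible process, let $l=\operatorname{essinf} X(0)\in[-\infty,\infty)$, and for $a>l$ (with $a\in\mathbb{R}$) and $t\in\mathbb{Z}$ let $$\tau_a(t)=\log \mathbb{P}[X(0)\le a, X(t)\le a]-\log\mathbb{P}[X(0)\le a]-\log\mathbb{P}[X(t)\le a].$$ Then the following conditions are equivalent: 1. $X$ is mixing. 2. $X$ is mixing of all orders. 3. For every $a>l$, $\lim_{t\to\infty}\tau_a(t)=0$.
   Context: A stochastic process $X=\{X(t),t\in\mathbb{Z}\}$ is called max-infinitely divisible (max-i.d.) if for every $n\in\mathbb{N}$ it can be represented (in law) as the maximum, taken componentwise (pointwise in $t$), of $n$ independent identically distributed stochastic processes; equivalently, for every finite-dimensional distribution function $F$ of $X$ and every $n\in\mathbb N$, $F^{1/n}$ is again a distribution function. Ergodic-theoretic notions refer to the shift acting on the law of $X$ on $\mathbb{R}^{\mathbb{Z}}$ with the product $\sigma$-algebra. For a measurable set $C\subset\mathbb{R}^{\mathbb{Z}}$, the event $A=\{X\in C\}$ and $t\in\mathbb{Z}$, write $A_t=\{(X(s+t))_{s\in\mathbb{Z}}\in C\}$. The process $X$ is mixing if $\lim_{t\to\infty}\mathbb{P}[A\cap B_t]=\mathbb{P}[A]\mathbb{P}[B]$ for all such events $A,B$. It is mixing of order $r\in\mathbb{N}$ if for all such events $A^{(0)},\dots,A^{(r)}$, $$\lim_{t_1,\dots,t_r\to+\infty}\mathbb{P}\big[A^{(0)}\cap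 A^{(1)}_{t_1}\cap A^{(2)}_{t_1+t_2}\cap\dots\cap A^{(r)}_{t_1+\dots+t_r}\big]=\mathbb{P}[A^{(0)}]\cdots\mathbb{P}[A^{(r)}],$$ and mixing of all orders if it is mixing of order $r$ for every $r\in\mathbb{N}$. *)

theory Defs
  imports "HOL-Probability.Probability"
begin

text \<open>A stochastic process on a probability space \<open>M\<close> is a family \<open>X :: int \<Rightarrow> 'a \<Rightarrow> real\<close> of real
  random variables; its law is a measure on the product sigma-algebra over all of \<open>int\<close>.\<close>

abbreviation path_space :: "(int \<Rightarrow> real) measure" where
  "path_space \<equiv> PiM UNIV (\<lambda>_. borel)"

definition process_law :: "'a measure \<Rightarrow> (int \<Rightarrow> 'a \<Rightarrow> real) \<Rightarrow> (int \<Rightarrow> real) measure" where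
  "process_law M X = distr M path_space (\<lambda>\<omega> s. X s \<omega>)"

definition stationary :: "'a measure \<Rightarrow> (int \<Rightarrow> 'a \<Rightarrow> real) \<Rightarrow> bool" where
  "stationary M X \<longleftrightarrow> (\<forall>t. process_law M (\<lambda>s. X (s + t)) = process_law M X)"

text \<open>\<open>Y i\<close> is the \<open>i\<close>-th of the \<open>n\<close> i.i.d. processes, as a random element of the path space. Taking
  their sample space to be of type \<open>nat \<Rightarrow> int \<Rightarrow> real\<close> is no restriction: \<open>n\<close> i.i.d. processes,
  wherever defined, have the same joint law as the coordinates of an \<open>n\<close>-fold product measure
  on that type.\<close>

definition max_infinitely_divisible :: "'a measure \<Rightarrow> (int \<Rightarrow> 'a \<Rightarrow> real) \<Rightarrow> bool" where
  "max_infinitely_divisible M X \<longleftrightarrow>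
     (\<forall>n::nat. n \<ge> 1 \<longrightarrow>
       (\<exists>(N :: (nat \<Rightarrow> int \<Rightarrow> real) measure) Y.
          prob_space N \<and>
          prob_space.indep_vars N (\<lambda>_. path_space) Y {..<n} \<and>
          (\<forall>i<n. \<forall>j<n. distr N path_space (Y i) = distr N path_space (Y j)) \<and>
          process_law M X = process_law N (\<lambda>t \<omega>. MAX i\<in>{..<n}. Y i \<omega> t)))"

text \<open>For \<open>A = {X \<in> C}\<close>, this is the shifted event \<open>A\<^sub>t\<close>.\<close>

definition shifted_event ::
  "'a measure \<Rightarrow> (int \<Rightarrow> 'a \<Rightarrow> real) \<Rightarrow> (int \<Rightarrow> real) set \<Rightarrow> int \<Rightarrow> 'a set" where
  "shifted_event M X C t = {\<omega> \<in> space M. (\<lambda>s. X (s + t) \<omega>) \<in> C}"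

definition mixing :: "'a measure \<Rightarrow> (int \<Rightarrow> 'a \<Rightarrow> real) \<Rightarrow> bool" where
  "mixing M X \<longleftrightarrow>
     (\<forall>C\<in>sets path_space. \<forall>D\<in>sets path_space.
        ((\<lambda>t. measure M (shifted_event M X C 0 \<inter> shifted_event M X D t)) \<longlongrightarrow>
           measure M (shifted_event M X C 0) * measure M (shifted_event M X D 0)) at_top)"

text \<open>The filter says that the coordinates \<open>t 1, \<dots>, t r\<close> tend to infinity jointly, at arbitrary
  relative rates; for \<open>i = 0\<close> the total shift \<open>\<Sum>j = 1..i. t j\<close> is \<open>0\<close>.\<close>

definition mixing_of_order :: "nat \<Rightarrow> 'a measure \<Rightarrow> (int \<Rightarrow> 'a \<Rightarrow> real) \<Rightarrow> bool" where
  "mixing_of_order r M X \<longleftrightarrow>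
     (\<forall>C :: nat \<Rightarrow> (int \<Rightarrow> real) set. (\<forall>i\<le>r. C i \<in> sets path_space) \<longrightarrow>
        ((\<lambda>t :: nat \<Rightarrow> int. measure M (\<Inter>i\<le>r. shifted_event M X (C i) (\<Sum>j = 1..i. t j))) \<longlongrightarrow>
           (\<Prod>i\<le>r. measure M (shifted_event M X (C i) 0)))
          (INF i\<in>{1..r}. filtercomap (\<lambda>t. t i) at_top))"

definition mixing_of_all_orders :: "'a measure \<Rightarrow> (int \<Rightarrow> 'a \<Rightarrow> real) \<Rightarrow> bool" where
  "mixing_of_all_orders M X \<longleftrightarrow> (\<forall>r\<ge>1. mixing_of_order r M X)"

definition essinf :: "'a measure \<Rightarrow> ('a \<Rightarrow> real) \<Rightarrow> ereal" where
  "essinf M f = - esssup M (\<lambda>\<omega>. - ereal (f \<omega>))"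

text \<open>Intended for \<open>a > essinf M (X 0)\<close> and \<open>X\<close> stationary and max-infinitely divisible, where all
  three probabilities are positive, so that the convention \<open>ln 0 = 0\<close> plays no role.\<close>

definition tau :: "'a measure \<Rightarrow> (int \<Rightarrow> 'a \<Rightarrow> real) \<Rightarrow> real \<Rightarrow> int \<Rightarrow> real" where
  "tau M X a t =
     ln (measure M {\<omega> \<in> space M. X 0 \<omega> \<le> a \<and> X t \<omega> \<le> a})
     - ln (measure M {\<omega> \<in> space M. X 0 \<omega> \<le> a})
     - ln (measure M {\<omega> \<in> space M. X t \<omega> \<le> a})"

end

theory Submission
  imports Defs
begin

text \<open>
  Mixing of order one is mixing, and mixing applied to the events \<open>X(0) \<le> a\<close> and \<open>X(t) \<le> a\<close> gives
  \<open>\<tau>\<^sub>a(t) \<longlongrightarrow> 0\<close>. The substance is that a condition on pairs of coordinates implies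
  mixing of all orders.

  Let \<open>P\<close> be the law of the process and \<open>Q n\<close> that of one of the \<open>n\<close> i.i.d. processes whose maximum has
  law \<open>P\<close>. For lower boxes \<open>A = {x. x s \<le> a s for s in a finite set}\<close> one has \<open>P A = (Q n A)\<^sup>n\<close>, and
  therefore \<open>- ln (P A) = lim n * Q n (- A)\<close> if \<open>P A > 0\<close>. By inclusion and exclusion the logarithmic dependence of
  two boxes, \<open>ln (P (A \<inter> B)) - ln (P A) - ln (P B)\<close>, is the limit of \<open>n * Q n (- A \<inter> - B)\<close>
  (\<open>joint_exceedance_tendsto\<close>). Although it is a combination of logarithms, it thus behaves like a
  measure of the set \<open>- A \<inter> - B\<close>: it is nonnegative, monotone and subadditive (\<open>depend_nonneg\<close>,
  \<open>depend_le_sum\<close>). A path outside both \<open>A\<close> and \<open>B\<close> exceeds some threshold of \<open>A\<close> and some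
  threshold of \<open>B\<close>, so the dependence of \<open>A\<close> and \<open>B\<close> is at most the sum over all pairs of times
  \<open>s\<close> of \<open>A\<close> and \<open>s'\<close> of \<open>B\<close> of the values \<open>\<tau>\<^sub>c(s' - s)\<close>, where \<open>c\<close> is the smaller of the two
  thresholds. If \<open>\<tau>\<^sub>c\<close> vanishes at infinity, the dependence between boxes with growing gaps vanishes,
  and any number of such boxes become independent (\<open>asymptotic_independence_lower_boxes\<close>).

  Boxes are stable under intersection and generate the product sigma-algebra, even if the thresholds
  avoid one real number; and since the shifts preserve \<open>P\<close>, asymptotic independence passes from a
  generator to all measurable sets, one coordinate at a time (\<open>tendsto_indep_extend\<close>).
\<close>

section \<open>Lower boxes in the path space\<close>

text \<open>A box is indexed by a finite set of pairs (time, threshold), rather than by a vector of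
  thresholds, because then intersecting two boxes is taking the union of their index sets, even if a
  time occurs twice, and shifting a box is translating its index set.\<close>

definition lower_box :: "(int \<times> real) set \<Rightarrow> (int \<Rightarrow> real) set" where
  "lower_box K = {x. \<forall>(s, a) \<in> K. x s \<le> a}"

definition translate :: "int \<Rightarrow> int \<times> real \<Rightarrow> int \<times> real" where
  "translate t = (\<lambda>(s, a). (s + t, a))"

definition path_shift :: "int \<Rightarrow> (int \<Rightarrow> real) \<Rightarrow> (int \<Rightarrow> real)" where
  "path_shift t x = (\<lambda>s. x (s + t))"

lemma space_path_space [simp]: "space path_space = UNIV"
  by (simp add: space_PiM)

lemma lower_box_empty [simp]: "lower_box {} = UNIV"
  by (simp add: lower_box_def)

lemma lower_box_Un: "lower_box (K \<union> L) = lower_box K \<inter> lower_box L"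
  by (auto simp: lower_box_def)

lemma lower_box_UN: "lower_box (\<Union>i\<in>I. K i) = (\<Inter>i\<in>I. lower_box (K i))"
  by (auto simp: lower_box_def)

lemma sets_lower_box [measurable]:
  assumes "finite K"
  shows "lower_box K \<in> sets path_space"
  using assms
proof (induction K)
  case (insert p K)
  obtain s a where p: "p = (s, a)" by force
  have "{x \<in> space path_space. x s \<le> a} \<in> sets path_space"
    by measurable
  moreover have "lower_box (insert p K) = {x \<in> space path_space. x s \<le> a} \<inter> lower_box K"
    by (auto simp: lower_box_def p space_PiM)
  ultimately show ?case using insert by auto
qed (use sets.top[of path_space] in simp)

lemma measurable_path_shift [measurable]: "path_shift t \<in> path_space \<rightarrow>\<^sub>M path_space"
  unfolding path_shift_def by (rule measurable_PiM_single') (auto simp: space_PiM)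

lemma path_shift_vimage_lower_box: "path_shift t -` lower_box K = lower_box (translate t ` K)"
  by (force simp: path_shift_def lower_box_def translate_def)

text \<open>Closed half-lines with thresholds in \<open>S\<close> approximate every closed half-line from above, so they
  generate the same sigma-algebra. The freedom in \<open>S\<close> serves to avoid the threshold
  \<open>essinf X(0)\<close>, about which a condition on the thresholds above the essential infimum says
  nothing although \<open>X(0)\<close> may have an atom there.\<close>

lemma sets_path_space_eq_sigma_lower_boxes:
  assumes dense: "\<And>a e. e > 0 \<Longrightarrow> \<exists>b\<in>S. a \<le> b \<and> b < a + e"
  shows "sets path_space = sigma_sets UNIV {lower_box K | K. finite K \<and> snd ` K \<subseteq> S}"
    (is "_ = sigma_sets UNIV ?G")
proof
  have sets_sigma: "sets (sigma UNIV ?G) = sigma_sets UNIV ?G" by (rule sets_measure_of) simp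
  have "(\<lambda>x. x) \<in> sigma UNIV ?G \<rightarrow>\<^sub>M path_space"
  proof (rule measurable_PiM_single'[where f = "\<lambda>s x. x s"])
    fix s :: int
    show "(\<lambda>x. x s) \<in> borel_measurable (sigma UNIV ?G)"
      unfolding borel_measurable_iff_le
    proof
      fix a :: real
      have "\<exists>b\<in>S. a \<le> b \<and> b < a + inverse (real (Suc n))" for n by (rule dense) simp
      then obtain b where b: "\<And>n. b n \<in> S" "\<And>n. a \<le> b n" "\<And>n. b n < a + inverse (real (Suc n))"
        by metis
      have "x s \<le> a" if "\<And>n. x s \<le> b n" for x :: "int \<Rightarrow> real"
      proof (rule field_le_epsilon)
        fix e :: real assume "e > 0"
        then obtain n where "inverse (real (Suc n)) < e" using reals_Archimedean by blast
        then show "x s \<le> a + e" using that[of n] b(3)[of n] by linarith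
      qed
      moreover have "x s \<le> b n" if "x s \<le> a" for x :: "int \<Rightarrow> real" and n
        using that b(2) order_trans by blast
      ultimately have "{x \<in> space (sigma UNIV ?G). x s \<le> a} = (\<Inter>n. lower_box {(s, b n)})"
        by (auto simp: lower_box_def space_measure_of_conv)
      also have "\<dots> \<in> sets (sigma UNIV ?G)"
      proof (rule sets.countable_INT)
        have "lower_box {(s, b n)} \<in> ?G" for n using b(1) by (intro CollectI exI[of _ "{(s, b n)}"]) auto
        then show "range (\<lambda>n. lower_box {(s, b n)}) \<subseteq> sets (sigma UNIV ?G)"
          unfolding sets_sigma by blast
      qed simp
      finally show "{x \<in> space (sigma UNIV ?G). x s \<le> a} \<in> sets (sigma UNIV ?G)" .
    qed
  qed (simp add: space_PiM)
  from measurable_sets[OF this] have "A \<in> sets (sigma UNIV ?G)" if "A \<in> sets path_space" for A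
    using that by (simp add: space_measure_of_conv)
  then show "sets path_space \<subseteq> sigma_sets UNIV ?G" unfolding sets_sigma by blast
  have "?G \<subseteq> sets path_space" by auto
  from sets.sigma_sets_subset[OF this] show "sigma_sets UNIV ?G \<subseteq> sets path_space" by simp
qed

section \<open>Extending asymptotic independence from a generator\<close>

text \<open>Dynkin's argument, replacing the generator sets by arbitrary measurable sets one coordinate at a
  time. The delicate closure property is the one under countable disjoint unions, where the limit
  along \<open>F\<close> has to be exchanged with the sum. It holds because the maps \<open>\<sigma> j t\<close> preserve \<open>P\<close>: the
  summands are bounded by \<open>P (D n)\<close> uniformly in \<open>t\<close>, so that the series converges uniformly.\<close>

lemma tendsto_indep_extend:
  fixes P :: "'x measure" and \<sigma> :: "'i \<Rightarrow> 't \<Rightarrow> 'x \<Rightarrow> 'x" and F :: "'t filter"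
  assumes "prob_space P" and "finite I"
    and G: "G \<subseteq> Pow (space P)" "Int_stable G" "space P \<in> G" "sets P = sigma_sets (space P) G"
    and meas: "\<And>i t. i \<in> I \<Longrightarrow> \<sigma> i t \<in> P \<rightarrow>\<^sub>M P"
    and pres: "\<And>i t. i \<in> I \<Longrightarrow> distr P P (\<sigma> i t) = P"
    and base: "\<And>C. (\<And>i. i \<in> I \<Longrightarrow> C i \<in> G) \<Longrightarrow>
      ((\<lambda>t. measure P {x \<in> space P. \<forall>i\<in>I. \<sigma> i t x \<in> C i}) \<longlongrightarrow> (\<Prod>i\<in>I. measure P (C i))) F"
    and C: "\<And>i. i \<in> I \<Longrightarrow> C i \<in> sets P"
  shows "((\<lambda>t. measure P {x \<in> space P. \<forall>i\<in>I. \<sigma> i t x \<in> C i}) \<longlongrightarrow> (\<Prod>i\<in>I. measure P (C i))) F"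
proof -
  interpret prob_space P by fact
  define good where "good C \<longleftrightarrow>
    ((\<lambda>t. prob {x \<in> space P. \<forall>i\<in>I. \<sigma> i t x \<in> C i}) \<longlongrightarrow> (\<Prod>i\<in>I. prob (C i))) F" for C
  have G_sets: "G \<subseteq> sets P" using G(4) by auto
  have "good C" if "J \<subseteq> I" "\<And>i. i \<in> J \<Longrightarrow> C i \<in> sets P" "\<And>i. i \<in> I - J \<Longrightarrow> C i \<in> G" for J C
  proof -
    have "finite J" using that(1) \<open>finite I\<close> finite_subset by blast
    then show ?thesis using that
    proof (induction J arbitrary: C)
      case empty
      then show ?case unfolding good_def by (intro base) auto
    next
      case (insert j J)
      have j: "j \<in> I" using insert.prems by auto
      have C: "C i \<in> sets P" if "i \<in> I" for i
        using insert.prems that G_sets by blast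
      define W where "W t = {x \<in> space P. \<forall>i\<in>I - {j}. \<sigma> i t x \<in> C i}" for t
      define c where "c = (\<Prod>i\<in>I - {j}. prob (C i))"
      define lim where "lim D \<longleftrightarrow> ((\<lambda>t. prob (W t \<inter> (\<sigma> j t -` D \<inter> space P))) \<longlongrightarrow> c * prob D) F" for D
      have good_iff: "good (C(j := D)) \<longleftrightarrow> lim D" for D
      proof -
        have "{x \<in> space P. \<forall>i\<in>I. \<sigma> i t x \<in> (C(j := D)) i} = W t \<inter> (\<sigma> j t -` D \<inter> space P)" for t
          using j by (auto simp: W_def)
        moreover have "(\<Prod>i\<in>I. prob ((C(j := D)) i)) = c * prob D"
          using j \<open>finite I\<close> by (subst prod.remove[of I j]) (auto simp: c_def mult.commute)
        ultimately show ?thesis unfolding good_def lim_def by simp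
      qed
      have W [measurable]: "W t \<in> sets P" for t
        unfolding W_def using \<open>finite I\<close> C
        by (intro sets.sets_Collect_finite_All) (auto intro!: measurable_sets_Collect[OF meas])
      have vim: "\<sigma> j t -` D \<inter> space P \<in> sets P" if "D \<in> sets P" for D t
        using meas[OF j] that by (rule measurable_sets)
      have inv: "prob (\<sigma> j t -` D \<inter> space P) = prob D" if "D \<in> sets P" for D t
        using measure_distr[OF meas[OF j, of t] that] pres[OF j, of t] by simp
      have lim_G: "lim D" if "D \<in> G" for D
        unfolding good_iff[symmetric] using insert.prems insert.hyps that by (intro insert.IH) auto
      \<comment> \<open>Dynkin induction on the set in coordinate \<open>j\<close>, with all other sets held fixed\<close>
      have "C j \<in> sigma_sets (space P) G" using C[OF j] G(4) by simp
      then have "lim (C j)"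
      proof (induction rule: sigma_sets_induct_disjoint[OF G(2,1), consumes 1, case_names basic empty compl union])
        case (basic D)
        then show ?case by (rule lim_G)
      next
        case empty
        then show ?case by (simp add: lim_def)
      next
        case (compl D)
        then have D: "D \<in> sets P" using G(4) by simp
        have "prob (W t \<inter> (\<sigma> j t -` (space P - D) \<inter> space P)) =
            prob (W t \<inter> (\<sigma> j t -` space P \<inter> space P)) - prob (W t \<inter> (\<sigma> j t -` D \<inter> space P))" for t
        proof -
          have "W t \<inter> (\<sigma> j t -` (space P - D) \<inter> space P) =
            (W t \<inter> (\<sigma> j t -` space P \<inter> space P)) - (W t \<inter> (\<sigma> j t -` D \<inter> space P))"
            by auto
          then show ?thesis
            using vim[OF D, of t] vim[OF sets.top, of t] sets.sets_into_space[OF D]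
            by (auto intro!: finite_measure_Diff)
        qed
        moreover have "c * prob (space P - D) = c * prob (space P) - c * prob D"
          unfolding prob_compl[OF D] prob_space by (simp add: algebra_simps)
        moreover have "lim (space P)" using G(3) by (rule lim_G)
        ultimately show ?case using compl(2) unfolding lim_def by (auto intro: tendsto_diff)
      next
        case (union D)
        then have D: "D n \<in> sets P" for n using G(4) by auto
        define f where "f n t = prob (W t \<inter> (\<sigma> j t -` D n \<inter> space P))" for n t
        have sums_D: "(\<lambda>n. prob (D n)) sums prob (\<Union>n. D n)"
          using D union(1) by (intro finite_measure_UNION) auto
        have "(\<lambda>n. f n t) sums prob (W t \<inter> (\<sigma> j t -` (\<Union>n. D n) \<inter> space P))" for t
        proof -
          have "(\<lambda>n. f n t) sums prob (\<Union>n. W t \<inter> (\<sigma> j t -` D n \<inter> space P))"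
            unfolding f_def
          proof (rule finite_measure_UNION)
            show "range (\<lambda>n. W t \<inter> (\<sigma> j t -` D n \<inter> space P)) \<subseteq> sets P"
              using vim[OF D] W by blast
            show "disjoint_family (\<lambda>n. W t \<inter> (\<sigma> j t -` D n \<inter> space P))"
              using union(1) unfolding disjoint_family_on_def by blast
          qed
          moreover have "(\<Union>n. W t \<inter> (\<sigma> j t -` D n \<inter> space P)) = W t \<inter> (\<sigma> j t -` (\<Union>n. D n) \<inter> space P)"
            by auto
          ultimately show ?thesis by simp
        qed
        then have suminf_f: "(\<Sum>n. f n t) = prob (W t \<inter> (\<sigma> j t -` (\<Union>n. D n) \<inter> space P))" for t
          by (rule sums_unique[symmetric])
        have "norm (f n t) \<le> prob (D n)" for n t
          unfolding f_def inv[OF D, of t n, symmetric] using vim[OF D]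
          by (auto intro!: finite_measure_mono)
        then have unif: "uniform_limit UNIV (\<lambda>n t. \<Sum>k<n. f k t) (\<lambda>t. \<Sum>k. f k t) sequentially"
          using sums_summable[OF sums_D] by (intro Weierstrass_m_test) auto
        have partial: "((\<lambda>t. \<Sum>k<n. f k t) \<longlongrightarrow> c * (\<Sum>k<n. prob (D k))) F" for n
          unfolding sum_distrib_left using union(3) by (intro tendsto_sum) (auto simp: lim_def f_def)
        have total: "(\<lambda>n. c * (\<Sum>k<n. prob (D k))) \<longlonglongrightarrow> c * prob (\<Union>n. D n)"
          using sums_D unfolding sums_def by (intro tendsto_intros)
        have "((\<lambda>t. \<Sum>k. f k t) \<longlongrightarrow> c * prob (\<Union>n. D n)) F"
          using always_eventually[OF allI[OF partial]] total unif
          by (rule swap_uniform_limit') simp_all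
        then show ?case by (simp add: lim_def suminf_f)
      qed
      then have "good (C(j := C j))" by (simp only: good_iff)
      then show ?case by simp
    qed
  qed
  from this[of I C] show ?thesis using C by (simp add: good_def)
qed

section \<open>Dependence under a max-infinitely divisible law\<close>

text \<open>This is the derivative of \<open>x \<mapsto> 1 - p\<^sup>x\<close> at \<open>0\<close>, taken along \<open>x = 1 / n\<close>. It turns logarithms of
  box probabilities into limits of probabilities of complements of boxes.\<close>
lemma scaled_root_deficit_tendsto:
  fixes p :: real
  assumes "p > 0"
  shows "(\<lambda>n. real n * (1 - p powr (1 / real n))) \<longlonglongrightarrow> - ln p"
proof -
  have "((\<lambda>x. 1 - p powr x) has_real_derivative - ln p) (at 0)"
    using assms by (auto intro!: derivative_eq_intros)
  then have lim: "((\<lambda>h. (1 - p powr h) / h) \<longlongrightarrow> - ln p) (at 0)"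
    using assms by (simp add: DERIV_def)
  have "filterlim (\<lambda>n. 1 / real n) (at 0) sequentially"
    unfolding filterlim_at using lim_1_over_n eventually_gt_at_top[of "0::nat"]
    by (auto elim: eventually_mono)
  from filterlim_compose[OF lim this] show ?thesis by (simp add: mult.commute)
qed

text \<open>\<open>Q n\<close> is the law of each of the \<open>n\<close> independent processes of which \<open>P\<close> is the law of the maximum. A
  maximum lies in a lower box if and only if every one of its arguments does, so on boxes \<open>Q n\<close> is the
  \<open>n\<close>-th root of \<open>P\<close>.\<close>

locale max_id_law =
  fixes P :: "(int \<Rightarrow> real) measure" and Q :: "nat \<Rightarrow> (int \<Rightarrow> real) measure"
  assumes prob_P: "prob_space P" and sets_P: "sets P = sets path_space"
    and prob_Q: "\<And>n. n \<ge> 1 \<Longrightarrow> prob_space (Q n)"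
    and sets_Q: "\<And>n. n \<ge> 1 \<Longrightarrow> sets (Q n) = sets path_space"
    and root: "\<And>n K. n \<ge> 1 \<Longrightarrow> finite K \<Longrightarrow> measure P (lower_box K) = measure (Q n) (lower_box K) ^ n"
begin

sublocale P: prob_space P by (rule prob_P)

abbreviation F :: "(int \<times> real) set \<Rightarrow> real" where
  "F K \<equiv> P.prob (lower_box K)"

definition depend :: "(int \<times> real) set \<Rightarrow> (int \<times> real) set \<Rightarrow> real" where
  "depend K L = ln (F (K \<union> L)) - ln (F K) - ln (F L)"

lemma sets_lower_box_P: "finite K \<Longrightarrow> lower_box K \<in> sets P"
  by (simp add: sets_P)

lemma F_antimono: "finite K \<Longrightarrow> lower_box L \<subseteq> lower_box K \<Longrightarrow> F L \<le> F K"
  by (intro P.finite_measure_mono sets_lower_box_P)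

lemma F_pos_Un:
  assumes "finite K" "finite L" "F (K \<union> L) > 0"
  shows "F K > 0" "F L > 0"
  using F_antimono[of K "K \<union> L"] F_antimono[of L "K \<union> L"] assms by (auto simp: lower_box_Un)

lemma root_eq_powr:
  assumes "n \<ge> 1" "finite K" "F K > 0"
  shows "measure (Q n) (lower_box K) = F K powr (1 / real n)"
proof -
  have "measure (Q n) (lower_box K) > 0"
    using root[OF assms(1,2)] assms(1,3) by (metis measure_nonneg less_le power_0_left not_one_le_zero)
  moreover have "F K = measure (Q n) (lower_box K) powr real n"
    using root[OF assms(1,2)] calculation by (simp add: powr_realpow)
  ultimately show ?thesis
    using assms(1) by (simp add: powr_powr)
qed

lemma exceedance_tendsto:
  assumes "finite K" "F K > 0"
  shows "(\<lambda>n. real n * (1 - measure (Q n) (lower_box K))) \<longlonglongrightarrow> - ln (F K)"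
proof (rule Lim_transform_eventually[OF scaled_root_deficit_tendsto[OF assms(2)]])
  show "\<forall>\<^sub>F n in sequentially. real n * (1 - F K powr (1 / real n)) = real n * (1 - measure (Q n) (lower_box K))"
    using eventually_ge_at_top[of 1] by eventually_elim (simp add: root_eq_powr assms)
qed

text \<open>By inclusion and exclusion, \<open>Q n (- A \<inter> - B) = (1 - Q n A) + (1 - Q n B) - (1 - Q n (A \<inter> B))\<close> for boxes
  \<open>A\<close> and \<open>B\<close>; scaled by \<open>n\<close>, each of the three deficits converges to minus a logarithm. So the
  logarithmic dependence is the limit of a measure of the set of paths that leave both boxes: it is the
  exponent measure of that set.\<close>

lemma joint_exceedance_tendsto:
  assumes "finite K" "finite L" "F (K \<union> L) > 0"
  shows "(\<lambda>n. real n * measure (Q n) (- lower_box K \<inter> - lower_box L)) \<longlonglongrightarrow> depend K L"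
proof (rule Lim_transform_eventually)
  note pos = F_pos_Un[OF assms]
  let ?e = "\<lambda>K n. real n * (1 - measure (Q n) (lower_box K))"
  show "(\<lambda>n. ?e K n + ?e L n - ?e (K \<union> L) n) \<longlonglongrightarrow> depend K L"
  proof -
    have "depend K L = - ln (F K) + - ln (F L) - - ln (F (K \<union> L))"
      by (simp add: depend_def)
    then show ?thesis
      using assms pos by (simp only:) (intro tendsto_add tendsto_diff exceedance_tendsto finite_UnI)
  qed
  show "\<forall>\<^sub>F n in sequentially. ?e K n + ?e L n - ?e (K \<union> L) n =
      real n * measure (Q n) (- lower_box K \<inter> - lower_box L)"
    using eventually_ge_at_top[of 1]
  proof eventually_elim
    case (elim n)
    interpret Q: prob_space "Q n" using prob_Q[OF elim] .
    have sp: "space (Q n) = UNIV" using sets_eq_imp_space_eq[OF sets_Q[OF elim]] by simp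
    have KL [simp]: "lower_box K \<in> Q.events" "lower_box L \<in> Q.events"
      using sets_Q[OF elim] assms by auto
    have "- lower_box K \<inter> - lower_box L = space (Q n) - (lower_box K \<union> lower_box L)"
      by (auto simp: sp)
    then have "Q.prob (- lower_box K \<inter> - lower_box L) = 1 - Q.prob (lower_box K \<union> lower_box L)"
      by (simp only: Q.prob_compl[OF sets.Un[OF KL]])
    also have "Q.prob (lower_box K \<union> lower_box L) =
        Q.prob (lower_box K) + Q.prob (lower_box L) - Q.prob (lower_box (K \<union> L))"
      using measure_Un3[of "lower_box K" "Q n" "lower_box L"]
      by (simp add: lower_box_Un Q.fmeasurable_eq_sets)
    finally have eq: "Q.prob (- lower_box K \<inter> - lower_box L) =
        1 - (Q.prob (lower_box K) + Q.prob (lower_box L) - Q.prob (lower_box (K \<union> L)))" .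
    show ?case unfolding eq by (simp add: algebra_simps)
  qed
qed

text \<open>A limit of measures is nonnegative: max-infinitely divisible laws are positively associated on
  boxes.\<close>

lemma depend_nonneg:
  assumes "finite K" "finite L" "F (K \<union> L) > 0"
  shows "depend K L \<ge> 0"
  using joint_exceedance_tendsto[OF assms] by (rule LIMSEQ_le_const) auto

text \<open>Being a limit of measures, the dependence is monotone and subadditive in the set
  \<open>- lower_box K \<inter> - lower_box L\<close>. This is what reduces the dependence between
  two blocks of coordinates to that between pairs of single coordinates.\<close>

lemma depend_le_sum:
  assumes fin: "finite I" "finite K" "finite L" "\<And>i. i \<in> I \<Longrightarrow> finite (K' i)" "\<And>i. i \<in> I \<Longrightarrow> finite (L' i)"
    and pos: "F (K \<union> L) > 0" "\<And>i. i \<in> I \<Longrightarrow> F (K' i \<union> L' i) > 0"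
    and cover: "- lower_box K \<inter> - lower_box L \<subseteq> (\<Union>i\<in>I. - lower_box (K' i) \<inter> - lower_box (L' i))"
  shows "depend K L \<le> (\<Sum>i\<in>I. depend (K' i) (L' i))"
proof (rule LIMSEQ_le)
  show "(\<lambda>n. real n * measure (Q n) (- lower_box K \<inter> - lower_box L)) \<longlonglongrightarrow> depend K L"
    using fin pos by (intro joint_exceedance_tendsto)
  show "(\<lambda>n. \<Sum>i\<in>I. real n * measure (Q n) (- lower_box (K' i) \<inter> - lower_box (L' i)))
      \<longlonglongrightarrow> (\<Sum>i\<in>I. depend (K' i) (L' i))"
    using fin pos by (intro tendsto_sum joint_exceedance_tendsto)
  have "real n * measure (Q n) (- lower_box K \<inter> - lower_box L) \<le>
      (\<Sum>i\<in>I. real n * measure (Q n) (- lower_box (K' i) \<inter> - lower_box (L' i)))" if "n \<ge> 1" for n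
  proof -
    interpret Q: prob_space "Q n" using prob_Q[OF that] .
    have compl: "- lower_box J \<in> Q.events" if "finite J" for J
      using sets.compl_sets[OF sets_lower_box[OF that]] sets_Q[OF \<open>n \<ge> 1\<close>] by (simp add: Compl_eq_Diff_UNIV)
    have "Q.prob (- lower_box K \<inter> - lower_box L) \<le> Q.prob (\<Union>i\<in>I. - lower_box (K' i) \<inter> - lower_box (L' i))"
      using fin compl cover by (intro Q.finite_measure_mono) auto
    also have "\<dots> \<le> (\<Sum>i\<in>I. Q.prob (- lower_box (K' i) \<inter> - lower_box (L' i)))"
      using fin compl by (intro Q.finite_measure_subadditive_finite) auto
    finally show ?thesis
      by (simp add: sum_distrib_left[symmetric] mult_left_mono)
  qed
  then show "\<exists>N. \<forall>n\<ge>N. real n * measure (Q n) (- lower_box K \<inter> - lower_box L) \<le>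
      (\<Sum>i\<in>I. real n * measure (Q n) (- lower_box (K' i) \<inter> - lower_box (L' i)))" by blast
qed

text \<open>For large \<open>n\<close> the \<open>n\<close>-th roots of the finitely many marginal probabilities are so close to \<open>1\<close> that
  the union bound leaves positive \<open>Q n\<close>-mass, hence positive \<open>P\<close>-mass, for the box.\<close>

lemma F_pos:
  assumes "finite K" and "\<And>p. p \<in> K \<Longrightarrow> F {p} > 0"
  shows "F K > 0"
proof -
  have "(\<lambda>n. \<Sum>p\<in>K. 1 - F {p} powr (1 / real n)) \<longlonglongrightarrow> (\<Sum>p\<in>K. 1 - F {p} powr 0)"
    using assms(2) lim_1_over_n by (intro tendsto_intros) (force simp: less_le)+
  also have "(\<Sum>p\<in>K. 1 - F {p} powr 0) = 0" using assms(2) by (intro sum.neutral) (force simp: less_le)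
  finally have "\<forall>\<^sub>F n in sequentially. (\<Sum>p\<in>K. 1 - F {p} powr (1 / real n)) < 1"
    by (rule order_tendstoD) simp
  with eventually_ge_at_top[of 1]
  have "\<forall>\<^sub>F n in sequentially. n \<ge> 1 \<and> (\<Sum>p\<in>K. 1 - F {p} powr (1 / real n)) < 1"
    by eventually_elim simp
  then obtain n where n: "n \<ge> 1" "(\<Sum>p\<in>K. 1 - F {p} powr (1 / real n)) < 1"
    by (auto simp: eventually_sequentially)
  interpret Q: prob_space "Q n" using prob_Q[OF n(1)] .
  have sp: "space (Q n) = UNIV" using sets_eq_imp_space_eq[OF sets_Q[OF n(1)]] by simp
  have ev: "lower_box J \<in> Q.events" if "finite J" for J
    using sets_Q[OF n(1)] that by auto
  have "1 - Q.prob (lower_box K) = Q.prob (space (Q n) - lower_box K)"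
    using Q.prob_compl[OF ev[OF assms(1)]] by simp
  also have "space (Q n) - lower_box K = (\<Union>p\<in>K. space (Q n) - lower_box {p})"
    by (auto simp: sp lower_box_def)
  also have "Q.prob \<dots> \<le> (\<Sum>p\<in>K. Q.prob (space (Q n) - lower_box {p}))"
    using assms(1) ev by (intro Q.finite_measure_subadditive_finite) auto
  also have "\<dots> = (\<Sum>p\<in>K. 1 - F {p} powr (1 / real n))"
    using assms(2) ev n(1) by (intro sum.cong refl) (simp add: Q.prob_compl root_eq_powr)
  finally have "Q.prob (lower_box K) > 0" using n(2) by simp
  then show ?thesis using root[OF n(1) assms(1)] by simp
qed

end

section \<open>Asymptotic independence of separated boxes\<close>

lemma filterlim_at_top_add_int:
  fixes f g :: "'t \<Rightarrow> int"
  assumes f: "eventually (\<lambda>t. c \<le> f t) F" and g: "filterlim g at_top F"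
  shows "filterlim (\<lambda>t. f t + g t) at_top F"
  unfolding filterlim_at_top
proof
  fix z
  have "eventually (\<lambda>t. z - c \<le> g t) F" using g by (simp add: filterlim_at_top)
  with f show "eventually (\<lambda>t. z \<le> f t + g t) F" by eventually_elim simp
qed

lemma filterlim_sum_at_top_int:
  fixes f :: "'i \<Rightarrow> 't \<Rightarrow> int"
  assumes "finite J" "J \<noteq> {}" "\<And>j. j \<in> J \<Longrightarrow> filterlim (f j) at_top F"
  shows "filterlim (\<lambda>t. \<Sum>j\<in>J. f j t) at_top F"
  using assms
proof (induction J rule: finite_ne_induct)
  case (insert j J)
  have "eventually (\<lambda>t. 0 \<le> f j t) F"
    using insert.prems[of j] by (simp add: filterlim_at_top)
  then show ?case
    using insert by (simp add: filterlim_at_top_add_int[where c = 0])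
qed simp

locale stationary_max_id_law = max_id_law +
  assumes invariant: "\<And>t. distr P P (path_shift t) = P"
begin

lemma path_shift_P [measurable]: "path_shift t \<in> P \<rightarrow>\<^sub>M P"
  using measurable_path_shift measurable_cong_sets[OF sets_P sets_P] by blast

lemma space_P: "space P = UNIV"
  using sets_eq_imp_space_eq[OF sets_P] by simp

lemma F_translate:
  assumes "finite K"
  shows "F (translate t ` K) = F K"
proof -
  have "F K = measure (distr P P (path_shift t)) (lower_box K)" by (simp add: invariant)
  also have "\<dots> = P.prob (path_shift t -` lower_box K \<inter> space P)"
    using assms by (intro measure_distr path_shift_P sets_lower_box_P)
  finally show ?thesis by (simp add: space_P path_shift_vimage_lower_box)
qed

lemma F_single: "F {(s, a)} = F {(0, a)}"
  using F_translate[of "{(0, a)}" s] by (simp add: translate_def)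

definition lag_depend :: "real \<Rightarrow> int \<Rightarrow> real" where
  "lag_depend a u = depend {(0, a)} {(u, a)}"

lemma depend_singles: "depend {(s, a)} {(s', a)} = lag_depend a (s' - s)"
proof -
  have "F {(s, a), (s', a)} = F {(0, a), (s' - s, a)}"
    using F_translate[of "{(0, a), (s' - s, a)}" s] by (simp add: translate_def)
  then show ?thesis
    using F_single[of s a] F_single[of s' a] F_single[of "s' - s" a]
    by (simp add: lag_depend_def depend_def insert_commute Un_insert_left)
qed

definition decoupled :: "real \<Rightarrow> bool" where
  "decoupled a \<longleftrightarrow> F {(0, a)} > 0 \<and> (lag_depend a \<longlongrightarrow> 0) at_top"

text \<open>The boxes are joined one after the other. If \<open>A\<close> is the intersection of the first ones and \<open>L\<close> the next
  one, then \<open>P (A \<inter> L) = P A * P L * exp (depend A L)\<close>, so the dependence has to vanish in the limit.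
  A path that leaves both \<open>A\<close> and \<open>L\<close> exceeds a threshold \<open>a\<close> at some time of \<open>A\<close> and a threshold \<open>b\<close> at
  some time of \<open>L\<close>. It therefore exceeds \<open>min a b\<close> at both times, and the dependence of that pair is a
  value of \<open>lag_depend (min a b)\<close> at a lag that tends to infinity.\<close>

lemma asymptotic_independence_lower_boxes:
  fixes T :: "nat \<Rightarrow> 't \<Rightarrow> int" and G :: "'t filter"
  assumes fin: "\<And>i. i \<le> r \<Longrightarrow> finite (K i)"
    and dec: "\<And>i s a. i \<le> r \<Longrightarrow> (s, a) \<in> K i \<Longrightarrow> decoupled a"
    and gaps: "\<And>i j. i < j \<Longrightarrow> j \<le> r \<Longrightarrow> filterlim (\<lambda>t. T j t - T i t) at_top G"
  shows "((\<lambda>t. F (\<Union>i\<le>r. translate (T i t) ` K i)) \<longlongrightarrow> (\<Prod>i\<le>r. F (K i))) G"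
proof -
  have "((\<lambda>t. F (\<Union>i\<le>k. translate (T i t) ` K i)) \<longlongrightarrow> (\<Prod>i\<le>k. F (K i))) G" if "k \<le> r" for k
    using that
  proof (induction k)
    case 0
    then show ?case using fin[of 0] by (simp add: F_translate)
  next
    case (Suc k)
    let ?A = "\<lambda>t. \<Union>i\<le>k. translate (T i t) ` K i"
    let ?L = "\<lambda>t. translate (T (Suc k) t) ` K (Suc k)"
    define I where "I = (SIGMA i:{..k}. K i \<times> K (Suc k))"
    define low where "low = (\<lambda>(i :: nat, (s :: int, a :: real), (s' :: int, b)). min a b)"
    define left where "left t = (\<lambda>(i :: nat, (s, a :: real), (s' :: int, b)). {(s + T i t, min a b)})" for t
    define right where "right t = (\<lambda>(i :: nat, (s :: int, a :: real), (s', b)). {(s' + T (Suc k) t, min a b)})" for t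
    define gap where "gap t = (\<lambda>(i, (s, a :: real), (s', b :: real)). (s' - s) + (T (Suc k) t - T i t))" for t
    have fin_I: "finite I" unfolding I_def using fin Suc.prems by auto
    have fin_A: "finite (?A t)" and fin_L: "finite (?L t)" for t using fin Suc.prems by auto
    have pos: "F J > 0" if "finite J" "\<And>s a. (s, a) \<in> J \<Longrightarrow> decoupled a" for J
    proof (rule F_pos[OF that(1)])
      fix p assume "p \<in> J"
      then show "F {p} > 0" using that(2) F_single[of "fst p" "snd p"] by (cases p) (auto simp: decoupled_def)
    qed
    have pos_AL: "F (?A t \<union> ?L t) > 0" for t
    proof (rule pos)
      fix s a assume "(s, a) \<in> ?A t \<union> ?L t"
      then have "(\<exists>i\<le>k. \<exists>s'. (s', a) \<in> K i) \<or> (\<exists>s'. (s', a) \<in> K (Suc k))"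
        by (auto simp: translate_def)
      then obtain i s' where "i \<le> Suc k" "(s', a) \<in> K i"
        by (metis le_SucI order_refl)
      then show "decoupled a" using dec Suc.prems le_trans by blast
    qed (use fin_A fin_L in simp)
    have dec_low: "decoupled (low c)" if "c \<in> I" for c
    proof -
      obtain i s a s' b where c: "c = (i, (s, a), (s', b))" by (metis prod.collapse)
      then have "decoupled a" "decoupled b"
        using that dec[of i s a] dec[of "Suc k" s' b] Suc.prems by (auto simp: I_def)
      then show ?thesis by (simp add: c low_def min_def)
    qed
    have depend_c: "depend (left t c) (right t c) = lag_depend (low c) (gap t c)" for t c
    proof -
      obtain i s a s' b where c: "c = (i, (s, a), (s', b))" by (metis prod.collapse)
      show ?thesis by (simp add: c left_def right_def low_def gap_def depend_singles algebra_simps)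
    qed
    \<comment> \<open>The cover runs over a fixed index set \<open>I\<close>, so that the sum has the same terms for every \<open>t\<close>.\<close>
    have upper: "depend (?A t) (?L t) \<le> (\<Sum>c\<in>I. lag_depend (low c) (gap t c))" for t
      unfolding depend_c[symmetric]
    proof (rule depend_le_sum)
      show "F (left t c \<union> right t c) > 0" if "c \<in> I" for c
        using dec_low[OF that] by (intro pos) (auto simp: left_def right_def low_def split: prod.splits)
      show "- lower_box (?A t) \<inter> - lower_box (?L t) \<subseteq> (\<Union>c\<in>I. - lower_box (left t c) \<inter> - lower_box (right t c))"
      proof
        fix x assume "x \<in> - lower_box (?A t) \<inter> - lower_box (?L t)"
        then obtain i s a s' b where "i \<le> k" "(s, a) \<in> K i" "\<not> x (s + T i t) \<le> a"
            "(s', b) \<in> K (Suc k)" "\<not> x (s' + T (Suc k) t) \<le> b"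
          by (auto simp: lower_box_def translate_def)
        then have "(i, (s, a), (s', b)) \<in> I"
          "x \<in> - lower_box (left t (i, (s, a), (s', b))) \<inter> - lower_box (right t (i, (s, a), (s', b)))"
          by (auto simp: I_def lower_box_def left_def right_def)
        then show "x \<in> (\<Union>c\<in>I. - lower_box (left t c) \<inter> - lower_box (right t c))" by blast
      qed
    qed (use fin_I fin_A fin_L pos_AL in \<open>auto simp: left_def right_def split: prod.splits\<close>)
    have "((\<lambda>t. \<Sum>c\<in>I. lag_depend (low c) (gap t c)) \<longlongrightarrow> (\<Sum>c\<in>I. 0)) G"
    proof (rule tendsto_sum)
      fix c assume "c \<in> I"
      obtain i s a s' b where c: "c = (i, (s, a), (s', b))" by (metis prod.collapse)
      have "filterlim (\<lambda>t. (s' - s) + (T (Suc k) t - T i t)) at_top G"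
        using gaps[of i "Suc k"] \<open>c \<in> I\<close> Suc.prems
        by (intro filterlim_at_top_add_int[where c = "s' - s"]) (auto simp: I_def c)
      then have "filterlim (\<lambda>t. gap t c) at_top G" by (simp add: gap_def c)
      moreover have "(lag_depend (low c) \<longlongrightarrow> 0) at_top"
        using dec_low[OF \<open>c \<in> I\<close>] by (simp add: decoupled_def)
      ultimately show "((\<lambda>t. lag_depend (low c) (gap t c)) \<longlongrightarrow> 0) G"
        by (rule filterlim_compose[rotated])
    qed
    then have sum_to_0: "((\<lambda>t. \<Sum>c\<in>I. lag_depend (low c) (gap t c)) \<longlongrightarrow> 0) G"
      by (simp only: sum.neutral_const)
    have "((\<lambda>t. depend (?A t) (?L t)) \<longlongrightarrow> 0) G"
      using always_eventually[OF allI[OF depend_nonneg[OF fin_A fin_L pos_AL]]]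
        always_eventually[OF allI[OF upper]] tendsto_const sum_to_0
      by (rule tendsto_sandwich)
    then have "((\<lambda>t. F (?A t) * F (K (Suc k)) * exp (depend (?A t) (?L t))) \<longlongrightarrow>
        (\<Prod>i\<le>k. F (K i)) * F (K (Suc k)) * exp 0) G"
      using Suc.IH Suc.prems by (intro tendsto_mult tendsto_exp tendsto_const) simp_all
    moreover have "F (\<Union>i\<le>Suc k. translate (T i t) ` K i) = F (?A t) * F (K (Suc k)) * exp (depend (?A t) (?L t))" for t
    proof -
      have "F (\<Union>i\<le>Suc k. translate (T i t) ` K i) = F (?A t \<union> ?L t)"
        by (simp add: atMost_Suc Un_commute)
      moreover have "F (?L t) = F (K (Suc k))" using fin Suc.prems by (intro F_translate) auto
      ultimately show ?thesis
        using pos_AL[of t] F_pos_Un[OF fin_A fin_L pos_AL, of t]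
        by (simp add: depend_def exp_diff)
    qed
    ultimately show ?case by simp
  qed
  then show ?thesis by simp
qed

end

section \<open>The law of a max-infinitely divisible process\<close>

lemma max_id_roots:
  assumes "prob_space M" and meas: "\<And>t. X t \<in> borel_measurable M"
    and "max_infinitely_divisible M X"
  shows "\<exists>Q. max_id_law (process_law M X) Q"
proof -
  interpret prob_space M by fact
  let ?P = "process_law M X"
  have path_map: "(\<lambda>\<omega> s. X s \<omega>) \<in> M \<rightarrow>\<^sub>M path_space"
    using meas by (intro measurable_PiM_single') auto
  have "\<exists>R. prob_space R \<and> sets R = sets path_space \<and>
      (\<forall>K. finite K \<longrightarrow> measure ?P (lower_box K) = measure R (lower_box K) ^ n)" if n: "n \<ge> 1" for n
  proof -
    obtain N :: "(nat \<Rightarrow> int \<Rightarrow> real) measure" and Y where "prob_space N"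
      and indep: "prob_space.indep_vars N (\<lambda>_. path_space) Y {..<n}"
      and same: "\<forall>i<n. \<forall>j<n. distr N path_space (Y i) = distr N path_space (Y j)"
      and max: "?P = process_law N (\<lambda>t \<omega>. MAX i\<in>{..<n}. Y i \<omega> t)"
      using assms(3) n unfolding max_infinitely_divisible_def by blast
    interpret N: prob_space N by fact
    let ?R = "distr N path_space (Y 0)"
    have ne: "{..<n} \<noteq> {}" using n by (metis lessThan_iff empty_iff less_le_trans zero_less_one)
    have Y: "Y i \<in> N \<rightarrow>\<^sub>M path_space" if "i < n" for i
      using indep that by (auto simp: N.indep_vars_def)
    have Y_at: "(\<lambda>\<omega>. Y i \<omega> t) \<in> borel_measurable N" if "i < n" for i t
      using measurable_compose[OF Y[OF that] measurable_component_singleton[of t UNIV "\<lambda>_. borel"]] by simp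
    have max_meas: "(\<lambda>\<omega> t. MAX i\<in>{..<n}. Y i \<omega> t) \<in> N \<rightarrow>\<^sub>M path_space"
      using Y_at by (intro measurable_PiM_single' borel_measurable_Max) auto
    have "measure ?P (lower_box K) = measure ?R (lower_box K) ^ n" if K: "finite K" for K
    proof -
      have "measure ?P (lower_box K) =
          N.prob ((\<lambda>\<omega> t. MAX i\<in>{..<n}. Y i \<omega> t) -` lower_box K \<inter> space N)"
        unfolding max using measure_distr[OF max_meas sets_lower_box[OF K]]
        by (simp only: process_law_def)
      also have "(\<lambda>\<omega> t. MAX i\<in>{..<n}. Y i \<omega> t) -` lower_box K \<inter> space N =
          (\<Inter>i\<in>{..<n}. Y i -` lower_box K \<inter> space N)"
      proof -
        have "(MAX i\<in>{..<n}. Y i \<omega> t) \<le> a \<longleftrightarrow> (\<forall>i\<in>{..<n}. Y i \<omega> t \<le> a)" for \<omega> t a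
          using ne by (subst Max_le_iff) auto
        then have "x \<in> (\<lambda>\<omega> t. MAX i\<in>{..<n}. Y i \<omega> t) -` lower_box K \<longleftrightarrow>
            (\<forall>i\<in>{..<n}. x \<in> Y i -` lower_box K)" for x
          unfolding lower_box_def vimage_def by blast
        then show ?thesis using ne by blast
      qed
      also have "N.prob \<dots> = (\<Prod>i\<in>{..<n}. N.prob (Y i -` lower_box K \<inter> space N))"
        using ne K by (intro N.indep_varsD_finite[OF indep]) simp_all
      also have "\<dots> = (\<Prod>i\<in>{..<n}. measure ?R (lower_box K))"
      proof (rule prod.cong[OF refl])
        fix i assume "i \<in> {..<n}"
        then have i: "i < n" by simp
        then have "measure ?R (lower_box K) = measure (distr N path_space (Y i)) (lower_box K)"
          using same n by (metis less_le_trans zero_less_one)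
        then show "N.prob (Y i -` lower_box K \<inter> space N) = measure ?R (lower_box K)"
          using K measure_distr[OF Y[OF i]] by simp
      qed
      finally show ?thesis by simp
    qed
    moreover have "prob_space ?R" using Y[of 0] n by (intro N.prob_space_distr) auto
    ultimately show ?thesis by (intro exI[of _ ?R]) simp
  qed
  then obtain Q where Q: "\<And>n. n \<ge> 1 \<Longrightarrow> prob_space (Q n) \<and> sets (Q n) = sets path_space \<and>
      (\<forall>K. finite K \<longrightarrow> measure ?P (lower_box K) = measure (Q n) (lower_box K) ^ n)"
    by metis
  have "prob_space ?P" unfolding process_law_def by (intro prob_space_distr path_map)
  then have "max_id_law ?P Q"
  proof (rule max_id_law.intro)
    show "sets ?P = sets path_space" by (simp add: process_law_def)
    show "prob_space (Q n)" "sets (Q n) = sets path_space" if "n \<ge> 1" for n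
      using Q[OF that] by simp_all
    show "measure ?P (lower_box K) = measure (Q n) (lower_box K) ^ n" if "n \<ge> 1" "finite K" for n K
      using Q[OF that(1)] that(2) by blast
  qed
  then show ?thesis by (intro exI[of _ Q])
qed

section \<open>Thresholds and the essential infimum\<close>

lemma (in prob_space) essinf_less_imp_prob_le_pos:
  assumes f: "f \<in> borel_measurable M" and "essinf M f < ereal a"
  shows "prob {\<omega> \<in> space M. f \<omega> \<le> a} > 0"
proof (rule ccontr)
  have S: "{\<omega> \<in> space M. f \<omega> \<le> a} \<in> events" using f by measurable
  assume "\<not> ?thesis"
  then have "prob {\<omega> \<in> space M. f \<omega> \<le> a} = 0" using zero_less_measure_iff by blast
  then have "AE \<omega> in M. \<not> f \<omega> \<le> a"
    using S by (simp add: AE_iff_measurable[OF _ refl] emeasure_eq_measure)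
  then have "AE \<omega> in M. - ereal (f \<omega>) \<le> - ereal a" by eventually_elim simp
  then have "esssup M (\<lambda>\<omega>. - ereal (f \<omega>)) \<le> - ereal a" using f by (intro esssup_I) measurable
  then have "- (- ereal a) \<le> essinf M f" unfolding essinf_def by (simp only: ereal_minus_le_minus)
  with assms(2) show False by simp
qed

lemma (in prob_space) prob_le_pos_imp_essinf_le:
  assumes f: "f \<in> borel_measurable M" and "prob {\<omega> \<in> space M. f \<omega> \<le> a} > 0"
  shows "essinf M f \<le> ereal a"
proof (rule ccontr)
  have S: "{\<omega> \<in> space M. f \<omega> \<le> a} \<in> events" using f by measurable
  assume "\<not> ?thesis"
  then have less: "esssup M (\<lambda>\<omega>. - ereal (f \<omega>)) < - ereal a"
    unfolding essinf_def not_le by (simp only: ereal_less_uminus_reorder)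
  have "AE \<omega> in M. - ereal (f \<omega>) \<le> esssup M (\<lambda>\<omega>. - ereal (f \<omega>))" by (rule esssup_AE)
  then have "AE \<omega> in M. \<not> f \<omega> \<le> a"
  proof eventually_elim
    case (elim \<omega>)
    then have "- ereal (f \<omega>) < - ereal a" using less by (rule le_less_trans)
    then show ?case by simp
  qed
  then have "prob {\<omega> \<in> space M. f \<omega> \<le> a} = 0"
    using S by (simp add: AE_iff_measurable[OF _ refl] emeasure_eq_measure)
  with assms(2) show False by simp
qed

section \<open>From events of the process to events of its law\<close>

context
  fixes M :: "'a measure" and X :: "int \<Rightarrow> 'a \<Rightarrow> real"
  assumes prob_M: "prob_space M" and meas: "\<And>t. X t \<in> borel_measurable M"
begin

interpretation prob_space M by (rule prob_M)

lemma measurable_path: "(\<lambda>\<omega> s. X s \<omega>) \<in> M \<rightarrow>\<^sub>M path_space"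
  using meas by (intro measurable_PiM_single') auto

lemma prob_process_law:
  assumes "A \<in> sets path_space"
  shows "measure (process_law M X) A = prob {\<omega> \<in> space M. (\<lambda>s. X s \<omega>) \<in> A}"
  using measure_distr[OF measurable_path assms]
  by (simp add: process_law_def vimage_def Collect_conj_eq Int_commute)

lemma distr_path_shift:
  assumes "stationary M X"
  shows "distr (process_law M X) (process_law M X) (path_shift t) = process_law M X"
proof -
  have "distr (process_law M X) (process_law M X) (path_shift t) =
      distr (distr M path_space (\<lambda>\<omega> s. X s \<omega>)) path_space (path_shift t)"
    by (intro distr_cong) (simp_all add: process_law_def)
  also have "\<dots> = process_law M (\<lambda>s. X (s + t))"
    by (subst distr_distr[OF measurable_path_shift measurable_path])
       (simp add: process_law_def comp_def path_shift_def)
  also have "\<dots> = process_law M X" using assms by (simp add: stationary_def)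
  finally show ?thesis .
qed

lemma prob_Inter_shifted_event:
  assumes "\<And>i. i \<le> r \<Longrightarrow> C i \<in> sets path_space"
  shows "prob (\<Inter>i\<le>r. shifted_event M X (C i) (T i)) =
    measure (process_law M X) {x \<in> space (process_law M X). \<forall>i\<in>{..r::nat}. path_shift (T i) x \<in> C i}"
proof -
  have sp: "space (process_law M X) = UNIV" by (simp add: process_law_def)
  have "{x \<in> space path_space. path_shift (T i) x \<in> C i} \<in> sets path_space" if "i \<le> r" for i
    using measurable_sets[OF measurable_path_shift assms[OF that]] by (simp add: vimage_def)
  then have "{x \<in> space path_space. \<forall>i\<in>{..r}. path_shift (T i) x \<in> C i} \<in> sets path_space"
    by (intro sets.sets_Collect_finite_All) auto
  then have "measure (process_law M X) {x. \<forall>i\<in>{..r}. path_shift (T i) x \<in> C i} =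
      prob {\<omega> \<in> space M. \<forall>i\<in>{..r}. (\<lambda>s. X (s + T i) \<omega>) \<in> C i}"
    by (simp add: prob_process_law path_shift_def)
  also have "{\<omega> \<in> space M. \<forall>i\<in>{..r}. (\<lambda>s. X (s + T i) \<omega>) \<in> C i} = (\<Inter>i\<le>r. shifted_event M X (C i) (T i))"
    by (auto simp: shifted_event_def)
  finally show ?thesis by (simp add: sp)
qed

lemma prob_shifted_event_0:
  assumes "A \<in> sets path_space"
  shows "prob (shifted_event M X A 0) = measure (process_law M X) A"
  using assms by (simp add: prob_process_law shifted_event_def)

text \<open>The pair of events becomes a family indexed by \<open>{0, 1}\<close>, and the filter of the single gap \<open>t 1\<close> is
  reached by constant sequences.\<close>

lemma mixing_of_order_1_imp_mixing:
  assumes "mixing_of_order 1 M X"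
  shows "mixing M X"
  unfolding mixing_def
proof (intro ballI)
  fix C D :: "(int \<Rightarrow> real) set" assume CD: "C \<in> sets path_space" "D \<in> sets path_space"
  define E where "E i = (if i = 0 then C else D)" for i :: nat
  have "\<forall>i\<le>1. E i \<in> sets path_space" using CD by (simp add: E_def)
  then have "((\<lambda>t :: nat \<Rightarrow> int. prob (\<Inter>i\<le>1. shifted_event M X (E i) (\<Sum>j = 1..i. t j))) \<longlongrightarrow>
      (\<Prod>i\<le>1. prob (shifted_event M X (E i) 0))) (INF i\<in>{1..1}. filtercomap (\<lambda>t. t i) at_top)"
    using assms unfolding mixing_of_order_def by blast
  moreover have "filterlim (\<lambda>u _. u) (INF i\<in>{1..1::nat}. filtercomap (\<lambda>t. t i) at_top) (at_top :: int filter)"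
    by (simp add: filterlim_filtercomap_iff comp_def filterlim_ident)
  ultimately have "((\<lambda>u :: int. prob (\<Inter>i\<le>1. shifted_event M X (E i) (\<Sum>j = 1..i. u))) \<longlongrightarrow>
      (\<Prod>i\<le>1. prob (shifted_event M X (E i) 0))) at_top"
    by (rule filterlim_compose)
  then show "((\<lambda>t. prob (shifted_event M X C 0 \<inter> shifted_event M X D t)) \<longlongrightarrow>
      prob (shifted_event M X C 0) * prob (shifted_event M X D 0)) at_top"
    by (simp add: E_def atMost_Suc Int_commute mult.commute)
qed

text \<open>The only threshold that can fail the condition is the essential infimum itself, when it is an
  atom of \<open>X(0)\<close>.\<close>

lemma charged_or_null_thresholds_dense:
  assumes "e > 0"
  shows "\<exists>b\<in>{a. prob {\<omega> \<in> space M. X 0 \<omega> \<le> a} = 0 \<or> essinf M (X 0) < ereal a}. a \<le> b \<and> b < a + e"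
proof (cases "prob {\<omega> \<in> space M. X 0 \<omega> \<le> a} = 0")
  case True
  then show ?thesis using assms by (intro bexI[of _ a]) auto
next
  case False
  then have "essinf M (X 0) \<le> ereal a"
    using meas by (intro prob_le_pos_imp_essinf_le) (auto simp: zero_less_measure_iff)
  also have "ereal a < ereal (a + e / 2)" using assms by simp
  finally show ?thesis using assms by (intro bexI[of _ "a + e / 2"]) auto
qed

end

section \<open>Mixing, mixing of all orders and vanishing dependence\<close>

text \<open>Applied to the event \<open>X(0) \<le> a\<close> and its shifts, mixing gives \<open>P (X(0) \<le> a, X(t) \<le> a) \<longlongrightarrow> p\<^sup>2\<close> with
  \<open>p = P (X(0) \<le> a) > 0\<close>, and taking logarithms shows that \<open>\<tau>\<^sub>a\<close> vanishes at infinity. For the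
  converse, asymptotic independence holds for boxes, hence for all measurable sets.\<close>

theorem theorem1p1:
  fixes M :: "'a measure" and X :: "int \<Rightarrow> 'a \<Rightarrow> real"
  assumes "prob_space M"
    and "\<And>t. X t \<in> borel_measurable M"
    and "stationary M X"
    and "max_infinitely_divisible M X"
  shows "(mixing M X \<longleftrightarrow> mixing_of_all_orders M X) \<and>
    (mixing M X \<longleftrightarrow> (\<forall>a::real. essinf M (X 0) < ereal a \<longrightarrow> (tau M X a \<longlongrightarrow> 0) at_top))"
proof -
  note proc = assms(1,2)
  interpret M: prob_space M by fact
  let ?P = "process_law M X"
  obtain Q where "max_id_law ?P Q" using max_id_roots[OF proc assms(4)] ..
  then interpret max_id_law ?P Q .
  interpret stationary_max_id_law ?P Q
    by unfold_locales (rule distr_path_shift[OF proc assms(3)])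
  have F_eq: "F K = M.prob {\<omega> \<in> space M. \<forall>(s, a)\<in>K. X s \<omega> \<le> a}" if "finite K" for K
    using prob_process_law[OF proc sets_lower_box[OF that]] by (simp add: lower_box_def)
  have F_single_eq: "F {(t, a)} = M.prob {\<omega> \<in> space M. X t \<omega> \<le> a}" for t a
    by (simp add: F_eq)
  have tau_eq: "tau M X a = lag_depend a" for a
    by (rule ext) (simp add: tau_def lag_depend_def depend_def F_eq Un_commute)
  have F_pos_above: "F {(t, a)} > 0" if "essinf M (X 0) < ereal a" for t a
    using M.essinf_less_imp_prob_le_pos[OF assms(2)[of 0] that] F_single[of t a] by (simp add: F_single_eq)

  have decay: "(tau M X a \<longlongrightarrow> 0) at_top" if "mixing M X" "essinf M (X 0) < ereal a" for a
  proof -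
    let ?p = "F {(0, a)}"
    let ?A = "lower_box {(0, a)}"
    have p: "?p > 0" using F_pos_above that(2) .
    have event: "shifted_event M X ?A t = {\<omega> \<in> space M. X t \<omega> \<le> a}" for t
      by (simp add: shifted_event_def lower_box_def)
    have "((\<lambda>t. M.prob (shifted_event M X ?A 0 \<inter> shifted_event M X ?A t)) \<longlongrightarrow> ?p * ?p) at_top"
      using that(1)[unfolded mixing_def, THEN bspec, THEN bspec, OF sets_lower_box sets_lower_box,
          of "{(0, a)}" "{(0, a)}"]
      by (simp add: event F_single_eq)
    moreover have "M.prob (shifted_event M X ?A 0 \<inter> shifted_event M X ?A t) =
        M.prob {\<omega> \<in> space M. X 0 \<omega> \<le> a \<and> X t \<omega> \<le> a}" for t
      unfolding event by (rule arg_cong[where f = M.prob]) auto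
    ultimately have "((\<lambda>t. M.prob {\<omega> \<in> space M. X 0 \<omega> \<le> a \<and> X t \<omega> \<le> a}) \<longlongrightarrow> ?p * ?p) at_top"
      by simp
    then have "((\<lambda>t. ln (M.prob {\<omega> \<in> space M. X 0 \<omega> \<le> a \<and> X t \<omega> \<le> a}) - ln ?p - ln ?p)
        \<longlongrightarrow> ln (?p * ?p) - ln ?p - ln ?p) at_top"
      using p by (intro tendsto_diff tendsto_ln tendsto_const) simp_all
    moreover have "tau M X a = (\<lambda>t. ln (M.prob {\<omega> \<in> space M. X 0 \<omega> \<le> a \<and> X t \<omega> \<le> a}) - ln ?p - ln ?p)"
    proof (rule ext)
      fix t
      show "tau M X a t = ln (M.prob {\<omega> \<in> space M. X 0 \<omega> \<le> a \<and> X t \<omega> \<le> a}) - ln ?p - ln ?p"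
        unfolding tau_def F_single_eq[symmetric] F_single[of t a] ..
    qed
    ultimately show ?thesis using p by (simp add: ln_mult)
  qed

  have all_orders: "mixing_of_order r M X"
    if dec: "\<And>a. essinf M (X 0) < ereal a \<Longrightarrow> (tau M X a \<longlongrightarrow> 0) at_top" for r
    unfolding mixing_of_order_def
  proof (intro allI impI)
    fix C :: "nat \<Rightarrow> (int \<Rightarrow> real) set"
    assume C: "\<forall>i\<le>r. C i \<in> sets path_space"
    define T where "T i t = (\<Sum>j = 1..i. t j)" for i and t :: "nat \<Rightarrow> int"
    define G where "G = (INF i\<in>{1..r}. filtercomap (\<lambda>t :: nat \<Rightarrow> int. t i) (at_top :: int filter))"
    \<comment> \<open>all thresholds except possibly \<open>essinf X(0)\<close> when it is an atom\<close>
    define S where "S = {a. M.prob {\<omega> \<in> space M. X 0 \<omega> \<le> a} = 0 \<or> essinf M (X 0) < ereal a}"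
    define B where "B = {lower_box K | K. finite K \<and> snd ` K \<subseteq> S}"
    have gaps: "filterlim (\<lambda>t. T j t - T i t) at_top G" if "i < j" "j \<le> r" for i j
    proof -
      have "T j t - T i t = (\<Sum>k\<in>{i<..j}. t k)" for t
        using sum.ub_add_nat[of 1 i t "j - i"] \<open>i < j\<close>
        by (simp add: T_def atLeastSucAtMost_greaterThanAtMost)
      moreover have "filterlim (\<lambda>t. \<Sum>k\<in>{i<..j}. t k) at_top G"
      proof (rule filterlim_sum_at_top_int)
        show "filterlim (\<lambda>t. t k) at_top G" if "k \<in> {i<..j}" for k
          unfolding G_def using that \<open>j \<le> r\<close> by (intro filterlim_INF'[of k] filterlim_filtercomap) auto
      qed (use \<open>i < j\<close> in auto)
      ultimately show ?thesis by simp
    qed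
    have "((\<lambda>t. P.prob {x \<in> space ?P. \<forall>i\<in>{..r}. path_shift (T i t) x \<in> C i}) \<longlongrightarrow>
        (\<Prod>i\<in>{..r}. P.prob (C i))) G"
    proof (rule tendsto_indep_extend[where G = B])
      show "prob_space ?P" by (rule prob_P)
      show "B \<subseteq> Pow (space ?P)" by (simp add: space_P)
      show "Int_stable B"
      proof (rule Int_stableI)
        fix A A' assume "A \<in> B" "A' \<in> B"
        then obtain K K' where "A = lower_box K" "A' = lower_box K'" "finite K" "finite K'"
            "snd ` K \<subseteq> S" "snd ` K' \<subseteq> S"
          unfolding B_def by blast
        then show "A \<inter> A' \<in> B"
          unfolding B_def by (intro CollectI exI[of _ "K \<union> K'"]) (auto simp: lower_box_Un)
      qed
      show "space ?P \<in> B"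
        unfolding B_def space_P by (intro CollectI exI[of _ "{}"]) simp
      show "sets ?P = sigma_sets (space ?P) B"
        unfolding sets_P space_P B_def S_def
        by (intro sets_path_space_eq_sigma_lower_boxes charged_or_null_thresholds_dense[OF proc])
      show "C i \<in> sets ?P" if "i \<in> {..r}" for i using C that by (simp add: sets_P)
      show "((\<lambda>t. P.prob {x \<in> space ?P. \<forall>i\<in>{..r}. path_shift (T i t) x \<in> E i}) \<longlongrightarrow>
          (\<Prod>i\<in>{..r}. P.prob (E i))) G" if "\<And>i. i \<in> {..r} \<Longrightarrow> E i \<in> B" for E
      proof -
        have "\<forall>i\<in>{..r}. \<exists>K. E i = lower_box K \<and> finite K \<and> snd ` K \<subseteq> S"
          using that unfolding B_def by blast
        then obtain K where K: "\<And>i. i \<le> r \<Longrightarrow> E i = lower_box (K i)" "\<And>i. i \<le> r \<Longrightarrow> finite (K i)"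
            "\<And>i. i \<le> r \<Longrightarrow> snd ` K i \<subseteq> S"
          by (metis atMost_iff)
        have event: "{x \<in> space ?P. \<forall>i\<in>{..r}. path_shift (T i t) x \<in> E i} =
            lower_box (\<Union>i\<le>r. translate (T i t) ` K i)" for t
          using K(1) by (auto simp: space_P lower_box_UN path_shift_vimage_lower_box[symmetric])
        have prod: "(\<Prod>i\<in>{..r}. P.prob (E i)) = (\<Prod>i\<le>r. F (K i))" using K(1) by simp
        show ?thesis
        \<comment> \<open>A box with a null threshold is null itself, and then both sides vanish.\<close>
        proof (cases "\<exists>i\<le>r. \<exists>(s, a)\<in>K i. F {(0, a)} = 0")
          case True
          then obtain i s a where i: "i \<le> r" "(s, a) \<in> K i" "F {(0, a)} = 0" by blast
          have "F (K i) \<le> F {(s, a)}" using i(2) by (intro F_antimono) (auto simp: lower_box_def)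
          then have zero: "F (K i) = 0" using i(3) F_single[of s a] by (simp add: measure_le_0_iff)
          have "F (\<Union>i\<le>r. translate (T i t) ` K i) \<le> F (translate (T i t) ` K i)" for t
            using i(1) K(2) by (intro F_antimono) (auto simp: lower_box_UN)
          then have "F (\<Union>i\<le>r. translate (T i t) ` K i) = 0" for t
            using zero F_translate[OF K(2)[OF i(1)]] by (simp add: measure_le_0_iff)
          moreover have "(\<Prod>i\<le>r. F (K i)) = 0"
            using i(1) zero by (intro prod_zero) auto
          ultimately show ?thesis unfolding event prod by (simp only: tendsto_const)
        next
          case False
          have "decoupled a" if "i \<le> r" "(s, a) \<in> K i" for i s a
          proof -
            have "F {(0, a)} \<noteq> 0" using False that by blast
            moreover have "a \<in> S" using K(3)[OF that(1)] that(2) by force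
            ultimately have "essinf M (X 0) < ereal a" by (simp add: S_def F_single_eq)
            then show ?thesis using dec[of a] F_pos_above by (simp add: decoupled_def tau_eq)
          qed
          then show ?thesis
            unfolding event prod using K(2) gaps by (intro asymptotic_independence_lower_boxes)
        qed
      qed
    qed (simp_all add: invariant)
    then show "((\<lambda>t. M.prob (\<Inter>i\<le>r. shifted_event M X (C i) (\<Sum>j = 1..i. t j))) \<longlongrightarrow>
        (\<Prod>i\<le>r. M.prob (shifted_event M X (C i) 0)))
        (INF i\<in>{1..r}. filtercomap (\<lambda>t. t i) at_top)"
      using C by (simp add: prob_Inter_shifted_event[OF proc] prob_shifted_event_0[OF proc] T_def G_def)
  qed
  have "mixing M X" if "mixing_of_all_orders M X"
    using that mixing_of_order_1_imp_mixing[OF proc] by (simp add: mixing_of_all_orders_def)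
  then show ?thesis
    using decay all_orders unfolding mixing_of_all_orders_def by blast
qed

end
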